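(* Let $M$ be a nested matroid on a finite ground set $E$ and let $\trianglelefteq$ be a left-justified order of $M$. Then the width of each of the BDDs $\mathsf{B}(\mathcal{I}(M))$, $\mathsf{B}(\mathcal{B}(M))$ and ZDDs $\mathsf{Z}(\mathcal{I}(M))$, $\mathsf{Z}(\mathcal{B}(M))$ with respect to $(E,\trianglelefteq)$ is at most $\mathrm{pw}(M)+1$.
   Context: $\mathcal{I}(M)$, $\mathcal{B}(M)$ are the collections of independent sets and bases. $M$ is nested if there are $A_1\subseteq\cdots\subseteq A_m\subseteq E$ such that $I$ is independent iff there is an injection $\varphi\colon I\to\{1,\ldots,m\}$ with $e\in A_{\varphi(e)}$ for all $e\in I$. For a total order $\preceq$ on $E$ and $k$-subsets $X,Y$ with elements in increasing order $x_1\prec\cdots\prec x_k$, $y_1\prec\cdots\prec y_k$, the Gale order is $X\le_{\preceq} Y$ iff $x_j\preceq y_j$ for all $j$; the Gale basis $G(M,\preceq)$ is the unique basis with $B\le_{\preceq}G(M,\preceq)$ for all bases $B$. A left-justified order of $M$ is a total order $\trianglelefteq$ on $E$ such that a set $B$ of size $r(M)$ is a basis iff $B\le_{\trianglelefteq}G(M,\trianglelefteq)$. $r_M$ is the rank function, $\lambda_M(X)=r_M(X)+r_M(E\setminus X)-r_M(E)$, and $\mathrm{pw}(M)=\min_{\preceq}\max_{i\in\{1,\ldots,n\}}\lambda_M(\{e_1,\ldots,e_i\})$ over total orders $e_1\prec\cdots\prec e_n$. Decision diagrams: for a total order $\preceq$ on $E$ and $\mathcal{S}\subseteq 2^E$,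 the BDD $\mathsf{B}(\mathcal{S})$ (resp. ZDD $\mathsf{Z}(\mathcal{S})$) is obtained from the complete binary decision tree of $\mathcal{S}$ (internal nodes at depth $j$ labeled by the $(j+1)$-th smallest element, each with a 0-arc to $\nu_0$ and a 1-arc to $\nu_1$; the leaf reached by taking 1-arcs exactly at elements of $X$ is $\top$ iff $X\in\mathcal{S}$, else $\bot$) by exhaustively applying: merge non-terminal nodes with the same label, same 0-successor and same 1-successor; and for BDDs remove every non-terminal $\nu$ with $\nu_0=\nu_1$, for ZDDs every non-terminal $\nu$ with $\nu_1=\bot$, redirecting arcs entering $\nu$ to $\nu_0$. If $e_1\prec\cdots\prec e_n$, the $i$-th width ($0\le i\le n-1$) is the number of non-terminal nodes labeled $e_{i+1}$; the width is the maximum over $i$. *)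

theory Defs
  imports Main
begin

locale matroid =
  fixes E :: "'a set" and \<I> :: "'a set set"
  assumes finite_ground: "finite E"
    and indep_subset_ground: "I \<in> \<I> \<Longrightarrow> I \<subseteq> E"
    and indep_empty: "{} \<in> \<I>"
    and indep_hereditary: "I \<in> \<I> \<Longrightarrow> J \<subseteq> I \<Longrightarrow> J \<in> \<I>"
    and indep_augment:
      "I \<in> \<I> \<Longrightarrow> J \<in> \<I> \<Longrightarrow> card I < card J \<Longrightarrow> \<exists>e\<in>J - I. insert e I \<in> \<I>"

definition bases :: "'a set set \<Rightarrow> 'a set set" where
  "bases \<I> = {B \<in> \<I>. \<forall>I\<in>\<I>. B \<subseteq> I \<longrightarrow> I = B}"

definition rank :: "'a set set \<Rightarrow> 'a set \<Rightarrow> nat" where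
  "rank \<I> X = Max (card ` {I \<in> \<I>. I \<subseteq> X})"

text \<open>The subtraction never truncates in a matroid; see \<open>rank_subadditive\<close> below.\<close>

definition connectivity :: "'a set \<Rightarrow> 'a set set \<Rightarrow> 'a set \<Rightarrow> nat" where
  "connectivity E \<I> X = rank \<I> X + rank \<I> (E - X) - rank \<I> E"

definition nested_matroid :: "'a set \<Rightarrow> 'a set set \<Rightarrow> bool" where
  "nested_matroid E \<I> \<longleftrightarrow> matroid E \<I> \<and>
     (\<exists>(m::nat) (A :: nat \<Rightarrow> 'a set).
        (\<forall>i\<in>{1..m}. A i \<subseteq> E) \<and>
        (\<forall>i\<in>{1..m}. \<forall>j\<in>{1..m}. i \<le> j \<longrightarrow> A i \<subseteq> A j) \<and>
        (\<forall>I. I \<subseteq> E \<longrightarrow>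
           (I \<in> \<I> \<longleftrightarrow>
             (\<exists>\<phi>. inj_on \<phi> I \<and> \<phi> ` I \<subseteq> {1..m} \<and> (\<forall>e\<in>I. e \<in> A (\<phi> e))))))"

text \<open>A total order on \<open>E\<close> is a relation \<open>R\<close> with \<open>linear_order_on E R\<close>, where \<open>(x, y) \<in> R\<close>
  means that \<open>x\<close> is below or equal to \<open>y\<close>.\<close>

definition increasing_list :: "'a rel \<Rightarrow> 'a set \<Rightarrow> 'a list" where
  "increasing_list R X =
     (THE xs. distinct xs \<and> set xs = X \<and> sorted_wrt (\<lambda>x y. (x, y) \<in> R) xs)"

definition gale_le :: "'a rel \<Rightarrow> 'a set \<Rightarrow> 'a set \<Rightarrow> bool" where
  "gale_le R X Y \<longleftrightarrow>
     list_all2 (\<lambda>x y. (x, y) \<in> R) (increasing_list R X) (increasing_list R Y)"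

definition gale_basis :: "'a set set \<Rightarrow> 'a rel \<Rightarrow> 'a set" where
  "gale_basis \<I> R = (THE G. G \<in> bases \<I> \<and> (\<forall>B\<in>bases \<I>. gale_le R B G))"

definition left_justified_order :: "'a set \<Rightarrow> 'a set set \<Rightarrow> 'a rel \<Rightarrow> bool" where
  "left_justified_order E \<I> R \<longleftrightarrow> linear_order_on E R \<and>
     (\<forall>B. B \<subseteq> E \<and> card B = rank \<I> E \<longrightarrow>
        (B \<in> bases \<I> \<longleftrightarrow> gale_le R B (gale_basis \<I> R)))"

text \<open>Both here and in the width of a decision diagram, inserting \<open>0\<close> only serves to give the
  maximum over the empty index range (that is, \<open>E = {}\<close>) the value \<open>0\<close>.\<close>

definition order_connectivity :: "'a set \<Rightarrow> 'a set set \<Rightarrow> 'a rel \<Rightarrow> nat" where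
  "order_connectivity E \<I> R =
     Max (insert 0
       ((\<lambda>i. connectivity E \<I> (set (take i (increasing_list R E)))) ` {1..card E}))"

definition pathwidth :: "'a set \<Rightarrow> 'a set set \<Rightarrow> nat" where
  "pathwidth E \<I> = Min (order_connectivity E \<I> ` {R. linear_order_on E R})"

text \<open>There is exactly one terminal of each kind, so all leaves of a decision tree with the same
  truth value are identified from the start.\<close>

datatype 'n vertex = Bot | Top | Inner 'n

record ('n, 'a) diagram =
  inner :: "'n set"
  lab :: "'n \<Rightarrow> 'a"
  succ0 :: "'n \<Rightarrow> 'n vertex"
  succ1 :: "'n \<Rightarrow> 'n vertex"
  root :: "'n vertex"

text \<open>A node of the complete decision tree is the list of arcs (\<open>True\<close> for a 1-arc) taken from the
  root to reach it.\<close>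

definition tree_vertex :: "'a list \<Rightarrow> 'a set set \<Rightarrow> bool list \<Rightarrow> bool list vertex" where
  "tree_vertex es \<S> p =
     (if length p < length es then Inner p
      else if {es ! i | i. i < length es \<and> p ! i} \<in> \<S> then Top else Bot)"

definition decision_tree ::
    "'a set \<Rightarrow> 'a rel \<Rightarrow> 'a set set \<Rightarrow> (bool list, 'a) diagram" where
  "decision_tree E R \<S> =
     (let es = increasing_list R E in
      \<lparr> inner = {p. length p < length es},
        lab = (\<lambda>p. es ! length p),
        succ0 = (\<lambda>p. tree_vertex es \<S> (p @ [False])),
        succ1 = (\<lambda>p. tree_vertex es \<S> (p @ [True])),
        root = tree_vertex es \<S> [] \<rparr>)"

definition redirect :: "'n \<Rightarrow> 'n vertex \<Rightarrow> 'n vertex \<Rightarrow> 'n vertex" where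
  "redirect v w x = (if x = Inner v then w else x)"

definition remove_node :: "'n \<Rightarrow> 'n vertex \<Rightarrow> ('n, 'a) diagram \<Rightarrow> ('n, 'a) diagram" where
  "remove_node v w D =
     \<lparr> inner = inner D - {v},
       lab = lab D,
       succ0 = redirect v w \<circ> succ0 D,
       succ1 = redirect v w \<circ> succ1 D,
       root = redirect v w (root D) \<rparr>"

inductive bdd_step :: "('n, 'a) diagram \<Rightarrow> ('n, 'a) diagram \<Rightarrow> bool" where
  bdd_merge: "\<lbrakk>u \<in> inner D; v \<in> inner D; u \<noteq> v; lab D u = lab D v;
     succ0 D u = succ0 D v; succ1 D u = succ1 D v\<rbrakk>
     \<Longrightarrow> bdd_step D (remove_node v (Inner u) D)"
| bdd_delete: "\<lbrakk>v \<in> inner D; succ0 D v = succ1 D v\<rbrakk>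
     \<Longrightarrow> bdd_step D (remove_node v (succ0 D v) D)"

inductive zdd_step :: "('n, 'a) diagram \<Rightarrow> ('n, 'a) diagram \<Rightarrow> bool" where
  zdd_merge: "\<lbrakk>u \<in> inner D; v \<in> inner D; u \<noteq> v; lab D u = lab D v;
     succ0 D u = succ0 D v; succ1 D u = succ1 D v\<rbrakk>
     \<Longrightarrow> zdd_step D (remove_node v (Inner u) D)"
| zdd_delete: "\<lbrakk>v \<in> inner D; succ1 D v = Bot\<rbrakk>
     \<Longrightarrow> zdd_step D (remove_node v (succ0 D v) D)"

text \<open>The outcome of exhaustive reduction depends on the order of the steps only through the names
  of the surviving nodes, so the BDD and the ZDD are rendered as predicates that hold for every
  possible outcome.\<close>

definition is_BDD ::
    "'a set \<Rightarrow> 'a rel \<Rightarrow> 'a set set \<Rightarrow> (bool list, 'a) diagram \<Rightarrow> bool" where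
  "is_BDD E R \<S> D \<longleftrightarrow> bdd_step\<^sup>*\<^sup>* (decision_tree E R \<S>) D \<and> (\<nexists>D'. bdd_step D D')"

definition is_ZDD ::
    "'a set \<Rightarrow> 'a rel \<Rightarrow> 'a set set \<Rightarrow> (bool list, 'a) diagram \<Rightarrow> bool" where
  "is_ZDD E R \<S> D \<longleftrightarrow> zdd_step\<^sup>*\<^sup>* (decision_tree E R \<S>) D \<and> (\<nexists>D'. zdd_step D D')"

definition level_width ::
    "'a set \<Rightarrow> 'a rel \<Rightarrow> ('n, 'a) diagram \<Rightarrow> nat \<Rightarrow> nat" where
  "level_width E R D i = card {v \<in> inner D. lab D v = increasing_list R E ! i}"

definition diagram_width :: "'a set \<Rightarrow> 'a rel \<Rightarrow> ('n, 'a) diagram \<Rightarrow> nat" where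
  "diagram_width E R D = Max (insert 0 (level_width E R D ` {0..<card E}))"

lemma (in matroid) rank_subadditive:
  assumes "X \<subseteq> E"
  shows "rank \<I> E \<le> rank \<I> X + rank \<I> (E - X)"
proof -
  have fin: "finite {I \<in> \<I>. I \<subseteq> Y}" for Y
    by (rule finite_subset[of _ "Pow E"]) (use indep_subset_ground finite_ground in auto)
  have "rank \<I> E \<in> card ` {I \<in> \<I>. I \<subseteq> E}"
    unfolding rank_def using fin indep_empty by (intro Max_in) auto
  then obtain I where I: "I \<in> \<I>" "I \<subseteq> E" "rank \<I> E = card I"
    by auto
  have le: "card (I \<inter> Y) \<le> rank \<I> Y" for Y
    unfolding rank_def using fin indep_hereditary[OF I(1)] by (intro Max_ge) auto
  have "I = (I \<inter> X) \<union> (I \<inter> (E - X))"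
    using I(2) by auto
  then have "card I \<le> card (I \<inter> X) + card (I \<inter> (E - X))"
    by (metis card_Un_le)
  then show ?thesis
    using le[of X] le[of "E - X"] I(3) by linarith
qed

lemma reduction_terminates:
  fixes D :: "('n, 'a) diagram" and step :: "('n, 'a) diagram \<Rightarrow> ('n, 'a) diagram \<Rightarrow> bool"
  assumes "finite (inner D)"
    and "\<And>D D'. step D D' \<Longrightarrow> \<exists>v\<in>inner D. inner D' = inner D - {v}"
  shows "\<exists>D'. step\<^sup>*\<^sup>* D D' \<and> (\<nexists>D''. step D' D'')"
  using assms(1)
proof (induction "card (inner D)" arbitrary: D rule: less_induct)
  case less
  show ?case
  proof (cases "\<exists>D1. step D D1")
    case True
    then obtain D1 where D1: "step D D1" by blast
    then obtain v where v: "v \<in> inner D" "inner D1 = inner D - {v}"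
      using assms(2) by blast
    have "card (inner D1) < card (inner D)"
      using less.prems v by (metis card_Diff1_less)
    then obtain D' where "step\<^sup>*\<^sup>* D1 D'" "\<nexists>D''. step D' D''"
      using less.hyps[of D1] less.prems v by auto
    then show ?thesis
      using D1 by (meson converse_rtranclp_into_rtranclp)
  qed blast
qed

lemma finite_inner_decision_tree: "finite (inner (decision_tree E R \<S>))"
proof -
  have "{p :: bool list. length p < n} \<subseteq> {p. set p \<subseteq> UNIV \<and> length p \<le> n}" for n
    by auto
  then have "finite {p :: bool list. length p < n}" for n
    by (rule finite_subset) (rule finite_lists_length_le, simp)
  then show ?thesis
    by (simp add: decision_tree_def Let_def)
qed

lemma ex_BDD: "\<exists>D. is_BDD E R \<S> D"
  unfolding is_BDD_def
  by (rule reduction_terminates[OF finite_inner_decision_tree])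
    (auto elim!: bdd_step.cases simp: remove_node_def)

lemma ex_ZDD: "\<exists>D. is_ZDD E R \<S> D"
  unfolding is_ZDD_def
  by (rule reduction_terminates[OF finite_inner_decision_tree])
    (auto elim!: zdd_step.cases simp: remove_node_def)

end

theory Submission
  imports Defs
begin

text \<open>Let \<open>P\<^sub>i\<close> be the set of the first \<open>i\<close> elements of the left-justified order, \<open>r\<close> the rank function
  and \<open>G\<close> the Gale basis, so that \<open>\<bar>G - P\<^sub>i\<bar> = r(E - P\<^sub>i)\<close> for all \<open>i\<close>. Independence of \<open>I\<close> amounts to
  \<open>\<bar>I - P\<^sub>i\<bar> \<le> r(E - P\<^sub>i)\<close> for all \<open>i\<close>. Hence the possible completions of a set \<open>X \<subseteq> P\<^sub>i\<close> to an independent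
  set or a basis are determined by the maximal size of a completion, which takes at most
  \<open>\<lambda>(P\<^sub>i) + 1\<close> values; as the nodes of a reduced diagram at level \<open>i\<close> have pairwise distinct nonempty
  subfunctions, there are at most \<open>\<lambda>(P\<^sub>i) + 1\<close> of them.

  The maximum of \<open>\<lambda>(P\<^sub>i)\<close> is \<open>k = \<bar>Q - G\<bar>\<close>, where \<open>Q\<close> consists of the first \<open>r(E)\<close> elements. Contracting
  \<open>Q \<inter> G\<close> and deleting the complement of \<open>Q \<union> G\<close> leaves the uniform matroid of rank \<open>k\<close> on \<open>2k\<close>
  elements, so every order has a prefix of connectivity at least \<open>k\<close>, namely one that contains
  exactly \<open>k\<close> of these elements. Therefore \<open>k \<le> pw(M)\<close>.\<close>

section \<open>Matroids with shifted bases\<close>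

lemma card_Diff_plus_card_Int: "finite A \<Longrightarrow> card (A - B) + card (A \<inter> B) = card A"
  by (metis Int_Diff_Un Int_Diff_disjoint add.commute card_Un_disjoint finite_Diff finite_Int)

section \<open>Rank, extension and bases in a finite matroid\<close>

context matroid
begin

lemma finite_indep_subsets: "finite {I \<in> \<I>. I \<subseteq> X}"
  by (rule finite_subset[of _ "Pow E"]) (use indep_subset_ground finite_ground in auto)

lemma finite_indep: "I \<in> \<I> \<Longrightarrow> finite I"
  using finite_ground indep_subset_ground finite_subset by blast

lemma card_le_rank: "I \<in> \<I> \<Longrightarrow> I \<subseteq> X \<Longrightarrow> card I \<le> rank \<I> X"
  unfolding rank_def using finite_indep_subsets by (intro Max_ge) auto

lemma rank_attained: "\<exists>I\<in>\<I>. I \<subseteq> X \<and> card I = rank \<I> X"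
proof -
  have "rank \<I> X \<in> card ` {I \<in> \<I>. I \<subseteq> X}"
    unfolding rank_def using finite_indep_subsets indep_empty by (intro Max_in) auto
  then show ?thesis by auto
qed

lemma rank_le_card: "finite X \<Longrightarrow> rank \<I> X \<le> card X"
  using rank_attained[of X] card_mono by metis

lemma rank_le_rank_ground: "rank \<I> X \<le> rank \<I> E"
  using rank_attained[of X] card_le_rank indep_subset_ground by metis

lemma extend_to_rank:
  assumes "I \<in> \<I>" "I \<subseteq> X"
  shows "\<exists>J\<in>\<I>. I \<subseteq> J \<and> J \<subseteq> X \<and> card J = rank \<I> X"
  using assms
proof (induction "rank \<I> X - card I" arbitrary: I rule: less_induct)
  case less
  show ?case
  proof (cases "card I = rank \<I> X")
    case False
    then have lt: "card I < rank \<I> X"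
      using card_le_rank[OF less.prems] by simp
    obtain K where K: "K \<in> \<I>" "K \<subseteq> X" "card K = rank \<I> X"
      using rank_attained by blast
    then obtain e where e: "e \<in> K - I" "insert e I \<in> \<I>"
      using indep_augment[OF less.prems(1), of K] lt by auto
    have "card (insert e I) = Suc (card I)"
      using e finite_indep[OF less.prems(1)] by simp
    then have "\<exists>J\<in>\<I>. insert e I \<subseteq> J \<and> J \<subseteq> X \<and> card J = rank \<I> X"
      using less.hyps[of "insert e I"] lt e K less.prems by auto
    then show ?thesis by auto
  qed (use less.prems in auto)
qed

lemma bases_iff: "B \<in> bases \<I> \<longleftrightarrow> B \<in> \<I> \<and> card B = rank \<I> E"
proof
  assume B: "B \<in> bases \<I>"
  then have "B \<in> \<I>" by (simp add: bases_def)
  moreover obtain J where "J \<in> \<I>" "B \<subseteq> J" "card J = rank \<I> E"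
    using extend_to_rank[OF \<open>B \<in> \<I>\<close>, of E] indep_subset_ground[OF \<open>B \<in> \<I>\<close>] by blast
  ultimately show "B \<in> \<I> \<and> card B = rank \<I> E"
    using B by (auto simp: bases_def)
next
  assume B: "B \<in> \<I> \<and> card B = rank \<I> E"
  have "I = B" if I: "I \<in> \<I>" "B \<subseteq> I" for I
    using card_subset_eq[of I B] card_le_rank[of I E] indep_subset_ground[OF I(1)]
      finite_indep[OF I(1)] I B card_mono[of I B] by auto
  with B show "B \<in> bases \<I>" by (auto simp: bases_def)
qed

end

text \<open>The prefix-count inequality is the relation that \<open>B'\<close> lies Gale-below
  \<open>B\<close>, stated without sorting the two sets. A left-justified order makes the bases a
  down-set for it.\<close>

locale shifted_matroid = matroid +
  fixes es :: "'a list"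
  assumes distinct_es: "distinct es" and set_es: "set es = E"
    and bases_shift: "\<lbrakk>B \<in> bases \<I>; B' \<subseteq> E; card B' = card B;
      \<And>i. card (B \<inter> set (take i es)) \<le> card (B' \<inter> set (take i es))\<rbrakk> \<Longrightarrow> B' \<in> bases \<I>"
begin

section \<open>Prefixes of the order and the Gale basis\<close>

definition pre :: "nat \<Rightarrow> 'a set" where
  "pre i = set (take i es)"

lemma pre_subset: "pre i \<subseteq> E"
  unfolding pre_def using set_es set_take_subset by metis

lemma finite_pre [simp]: "finite (pre i)"
  by (simp add: pre_def)

lemma pre_mono: "i \<le> j \<Longrightarrow> pre i \<subseteq> pre j"
  unfolding pre_def by (rule set_take_subset_set_take)

lemma pre_0 [simp]: "pre 0 = {}"
  by (simp add: pre_def)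

lemma length_es: "length es = card E"
  using distinct_es set_es distinct_card by metis

lemma card_pre: "card (pre i) = min i (card E)"
  unfolding pre_def using distinct_es length_es by (simp add: distinct_card)

text \<open>Greedy choice from the large end: a maximal independent subset of one suffix is extended
  to the next longer suffix, so a single basis attains the rank of every suffix.\<close>

lemma ex_gale_maximal_basis: "\<exists>G\<in>bases \<I>. \<forall>j. card (G - pre j) = rank \<I> (E - pre j)"
proof -
  have "\<exists>I\<in>\<I>. I \<subseteq> E - pre i \<and> (\<forall>j\<ge>i. card (I - pre j) = rank \<I> (E - pre j))"
    if "i \<le> card E" for i
    using that
  proof (induction i rule: inc_induct)
    case base
    have "pre j = E" if "j \<ge> card E" for j
      using that set_es length_es by (simp add: pre_def)
    then show ?case
      using indep_empty rank_attained[of "{}"] by (intro bexI[of _ "{}"]) auto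
  next
    case (step i)
    then obtain I where I: "I \<in> \<I>" "I \<subseteq> E - pre (Suc i)"
      "\<And>j. j \<ge> Suc i \<Longrightarrow> card (I - pre j) = rank \<I> (E - pre j)" by blast
    have "I \<subseteq> E - pre i"
      using I(2) pre_mono[of i "Suc i"] by auto
    then obtain J where J: "J \<in> \<I>" "I \<subseteq> J" "J \<subseteq> E - pre i" "card J = rank \<I> (E - pre i)"
      using extend_to_rank[OF I(1)] by blast
    have "card (J - pre j) = rank \<I> (E - pre j)" if "j \<ge> i" for j
    proof (cases "j = i")
      case True
      then have "J - pre j = J" using J(3) by auto
      with True J(4) show ?thesis by simp
    next
      case False
      then have "card (I - pre j) = rank \<I> (E - pre j)"
        using that I(3) by simp
      moreover have "card (I - pre j) \<le> card (J - pre j)"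
        using J(2) finite_indep[OF J(1)] by (intro card_mono) auto
      moreover have "card (J - pre j) \<le> rank \<I> (E - pre j)"
        using indep_hereditary[OF J(1)] J(3) by (intro card_le_rank) auto
      ultimately show ?thesis by simp
    qed
    with J show ?case by blast
  qed
  from this[of 0] obtain G where G: "G \<in> \<I>" "\<And>j. card (G - pre j) = rank \<I> (E - pre j)"
    by auto
  from G(2)[of 0] have "card G = rank \<I> E" by simp
  with G(1) have "G \<in> bases \<I>" by (simp add: bases_iff)
  with G(2) show ?thesis by blast
qed

text \<open>Attaining every suffix rank means that no basis has more elements in any suffix; this is
  the Gale basis, characterised by counts.\<close>

definition G :: "'a set" where
  "G = (SOME G. G \<in> bases \<I> \<and> (\<forall>j. card (G - pre j) = rank \<I> (E - pre j)))"

lemma G_basis: "G \<in> bases \<I>" and card_G_diff_pre: "card (G - pre j) = rank \<I> (E - pre j)"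
proof -
  have "\<exists>G. G \<in> bases \<I> \<and> (\<forall>j. card (G - pre j) = rank \<I> (E - pre j))"
    using ex_gale_maximal_basis by blast
  from someI_ex[OF this] show "G \<in> bases \<I>" "card (G - pre j) = rank \<I> (E - pre j)"
    unfolding G_def by blast+
qed

section \<open>Independence through bounds on suffix counts\<close>

lemma finite_G: "finite G" and card_G: "card G = rank \<I> E"
  using G_basis bases_iff finite_indep by auto

lemma rank_suffix: "rank \<I> (E - pre j) + card (G \<inter> pre j) = rank \<I> E"
proof -
  have "card (G - pre j) + card (G \<inter> pre j) = card G"
    using finite_G by (rule card_Diff_plus_card_Int)
  then show ?thesis by (simp add: card_G card_G_diff_pre)
qed

lemma card_G_pre_le: "card (G \<inter> pre j) \<le> j"
  using card_mono[of "pre j" "G \<inter> pre j"] card_pre[of j] by auto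

text \<open>A set of size \<open>rank \<I> E\<close> within the bounds lies Gale-below
  \<open>G\<close> and is a basis by shifting; a smaller set is enlarged within the bounds until it
  has that size.\<close>

lemma indep_iff: "I \<in> \<I> \<longleftrightarrow> I \<subseteq> E \<and> (\<forall>j. card (I - pre j) \<le> rank \<I> (E - pre j))"
proof
  assume I: "I \<in> \<I>"
  have "card (I - pre j) \<le> rank \<I> (E - pre j)" for j
    using indep_hereditary[OF I] indep_subset_ground[OF I] by (intro card_le_rank) auto
  with I show "I \<subseteq> E \<and> (\<forall>j. card (I - pre j) \<le> rank \<I> (E - pre j))"
    using indep_subset_ground by blast
next
  assume "I \<subseteq> E \<and> (\<forall>j. card (I - pre j) \<le> rank \<I> (E - pre j))"
  then show "I \<in> \<I>"
  proof (induction "rank \<I> E - card I" arbitrary: I rule: less_induct)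
    case less
    then have I: "I \<subseteq> E" "\<And>j. card (I - pre j) \<le> rank \<I> (E - pre j)" by auto
    have fin: "finite I" using I(1) finite_ground finite_subset by blast
    have le: "card I \<le> rank \<I> E" using I(2)[of 0] by simp
    show ?case
    proof (cases "card I = rank \<I> E")
      case True
      \<comment> \<open>At equal sizes, upper bounds on suffix counts are lower bounds on prefix
        counts.\<close>
      have "card (G \<inter> pre i) \<le> card (I \<inter> pre i)" for i
      proof -
        have "card (I - pre i) + card (I \<inter> pre i) = card I"
          using fin by (rule card_Diff_plus_card_Int)
        then show ?thesis using I(2)[of i] rank_suffix[of i] True by linarith
      qed
      then have "I \<in> bases \<I>"
        using bases_shift[OF G_basis I(1)] True card_G by (simp add: pre_def)
      then show ?thesis by (simp add: bases_iff)
    next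
      case False
      then have lt: "card I < rank \<I> E" using le by simp
      then have "I \<noteq> E" using rank_le_card[OF finite_ground] by auto
      \<comment> \<open>Adding the earliest missing element preserves the bounds, since the prefix before it
        already lies in \<open>I\<close>.\<close>
      then have ex: "\<exists>m. m < length es \<and> es ! m \<notin> I"
        using I(1) set_es by (metis in_set_conv_nth subsetI subset_antisym)
      define m where "m = (LEAST m. m < length es \<and> es ! m \<notin> I)"
      have m: "m < length es" "es ! m \<notin> I"
        using LeastI_ex[OF ex] unfolding m_def by auto
      have before: "es ! l \<in> I" if "l < m" for l
        using not_less_Least[of l "\<lambda>m. m < length es \<and> es ! m \<notin> I"] that m(1)
        unfolding m_def[symmetric] by auto
      let ?J = "insert (es ! m) I"
      have "card (?J - pre j) \<le> rank \<I> (E - pre j)" for j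
      proof (cases "m < j")
        case True
        then have "es ! m \<in> pre j"
          using m(1) by (auto simp: pre_def in_set_conv_nth)
        then have "?J - pre j = I - pre j" by auto
        then show ?thesis using I(2) by simp
      next
        case False
        then have "pre j \<subseteq> ?J"
          using before m(1) by (auto simp: pre_def in_set_conv_nth)
        \<comment> \<open>All \<open>j\<close> elements of \<open>pre j\<close> lie in
          \<open>?J\<close>, whereas at most \<open>j\<close> elements of \<open>G\<close> lie in
          \<open>pre j\<close>; so the suffix still has rank at least
          \<open>rank \<I> E - j\<close>.\<close>
        then have "card (?J - pre j) = Suc (card I) - j"
          using fin m False length_es by (simp add: card_Diff_subset card_pre)
        then show ?thesis
          using rank_suffix[of j] card_G_pre_le[of j] lt by linarith
      qed
      moreover have "?J \<subseteq> E" using I(1) m(1) set_es by auto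
      moreover have "rank \<I> E - card ?J < rank \<I> E - card I"
        using fin m(2) lt by simp
      ultimately have "?J \<in> \<I>" using less.hyps by blast
      then show ?thesis using indep_hereditary by blast
    qed
  qed
qed

text \<open>The bounds of \<open>indep_iff\<close> at \<open>j \<ge> i\<close> involve only the part
  outside \<open>pre i\<close>, and those at \<open>j < i\<close> see that part only through its
  size.\<close>

lemma indep_suffix_exchange:
  assumes "X \<subseteq> pre i" "Y \<subseteq> E - pre i" "Y' \<subseteq> E - pre i" "X \<union> Y' \<in> \<I>" "Y \<in> \<I>"
    "card Y \<le> card Y'"
  shows "X \<union> Y \<in> \<I>"
  unfolding indep_iff
proof (intro conjI allI)
  show "X \<union> Y \<subseteq> E" using assms pre_subset by blast
  fix j
  show "card ((X \<union> Y) - pre j) \<le> rank \<I> (E - pre j)"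
  proof (cases "i \<le> j")
    case True
    then have "(X \<union> Y) - pre j = Y - pre j"
      using assms(1) pre_mono by blast
    then show ?thesis using assms(5) indep_iff by simp
  next
    case False
    then have sub: "pre j \<subseteq> pre i" using pre_mono by simp
    have fin: "finite (X - pre j)" "finite Y" "finite Y'"
      using finite_indep[OF assms(4)] finite_indep[OF assms(5)] by auto
    have eq: "card ((X \<union> V) - pre j) = card (X - pre j) + card V"
      if "V \<subseteq> E - pre i" "finite V" for V
    proof -
      have "(X \<union> V) - pre j = (X - pre j) \<union> V" "(X - pre j) \<inter> V = {}"
        using that assms(1) sub by auto
      then show ?thesis using that fin card_Un_disjoint by metis
    qed
    have "card ((X \<union> Y') - pre j) \<le> rank \<I> (E - pre j)"
      using assms(4) indep_iff by blast
    then show ?thesis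
      using eq[of Y] eq[of Y'] assms fin by simp
  qed
qed

section \<open>Residuals: the subfunctions of the decision tree as families of completions\<close>

definition residual :: "'a set set \<Rightarrow> nat \<Rightarrow> 'a set \<Rightarrow> 'a set set" where
  "residual \<S> i X = {Y. Y \<subseteq> E - pre i \<and> X \<union> Y \<in> \<S>}"

lemma finite_residual: "finite (residual \<S> i X)"
  by (rule finite_subset[of _ "Pow E"]) (use finite_ground in \<open>auto simp: residual_def\<close>)

text \<open>A residual is recovered from the largest size of its members, which lies between
  \<open>r(E) - r(pre i)\<close> and \<open>r(E - pre i)\<close>.\<close>

lemma card_residuals_le:
  assumes S: "\<S> = \<I> \<or> \<S> = bases \<I>"
  shows "card (residual \<S> i ` Pow (pre i) - {{}}) \<le> connectivity E \<I> (pre i) + 1"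
proof -
  \<comment> \<open>Without the empty residual, which stands for the terminal \<open>Bot\<close>,
    every maximal size is attained.\<close>
  let ?F = "residual \<S> i ` Pow (pre i) - {{}}"
  define \<mu> :: "'a set set \<Rightarrow> nat" where "\<mu> K = Max (card ` K)" for K
  have SI: "Z \<in> \<I>" if "Z \<in> \<S>" for Z using that S bases_iff by auto
  have att: "\<exists>Y\<in>K. card Y = \<mu> K" if "K \<in> ?F" for K
  proof -
    have "\<mu> K \<in> card ` K"
      unfolding \<mu>_def using that finite_residual by (intro Max_in) auto
    then show ?thesis by auto
  qed
  have ub: "card Y \<le> \<mu> K" if "K \<in> ?F" "Y \<in> K" for K Y
    unfolding \<mu>_def using that finite_residual by (intro Max_ge) auto
  have cardU: "card (X \<union> Y) = card X + card Y" if "X \<subseteq> pre i" "Y \<subseteq> E - pre i" for X Y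
    using that finite_subset[of Y E] finite_subset[of X "pre i"] finite_ground
    by (intro card_Un_disjoint) auto
  \<comment> \<open>Equal maximal sizes make every member of one residual no larger than a largest
    member \<open>Y'\<close> of the other, so it may replace \<open>Y'\<close> by suffix
    exchange.\<close>
  have transfer: "residual \<S> i X \<subseteq> residual \<S> i X'"
    if h: "X \<subseteq> pre i" "X' \<subseteq> pre i" "residual \<S> i X \<in> ?F" "residual \<S> i X' \<in> ?F"
      "\<mu> (residual \<S> i X) = \<mu> (residual \<S> i X')" for X X'
  proof
    fix Y assume Y: "Y \<in> residual \<S> i X"
    obtain Y' where Y': "Y' \<in> residual \<S> i X'" "card Y' = \<mu> (residual \<S> i X')"
      using att[OF h(4)] by blast
    obtain Z where Z: "Z \<in> residual \<S> i X" "card Z = \<mu> (residual \<S> i X)"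
      using att[OF h(3)] by blast
    have le: "card Y \<le> card Y'" using ub[OF h(3) Y] Y'(2) h(5) by simp
    have in_S: "X \<union> Y \<in> \<S>" "X' \<union> Y' \<in> \<S>" "X \<union> Z \<in> \<S>"
      and sub: "Y \<subseteq> E - pre i" "Y' \<subseteq> E - pre i" "Z \<subseteq> E - pre i"
      using Y Y'(1) Z(1) by (auto simp: residual_def)
    have "Y \<in> \<I>" by (rule indep_hereditary[OF SI[OF in_S(1)]]) simp
    then have ind: "X' \<union> Y \<in> \<I>"
      by (rule indep_suffix_exchange[OF h(2) sub(1,2) SI[OF in_S(2)] _ le])
    have "X' \<union> Y \<in> \<S>"
    proof (cases "\<S> = \<I>")
      case False
      then have B: "\<S> = bases \<I>" using S by simp
      \<comment> \<open>For bases all members of a residual have size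
        \<open>rank \<I> E - card X\<close>, so equal maximal sizes force
        \<open>card X = card X'\<close>.\<close>
      have "card X + card Y = rank \<I> E" "card X + card Z = rank \<I> E"
        "card X' + card Y' = rank \<I> E"
        using in_S unfolding B bases_iff cardU[OF h(1) sub(1)] cardU[OF h(1) sub(3)]
          cardU[OF h(2) sub(2)] by auto
      then have "card (X' \<union> Y) = rank \<I> E"
        using cardU[OF h(2) sub(1)] Y'(2) Z(2) h(5) by simp
      then show ?thesis using ind B bases_iff by simp
    qed (use ind in simp)
    then show "Y \<in> residual \<S> i X'" using sub(1) by (simp add: residual_def)
  qed
  have inj: "inj_on \<mu> ?F"
  proof (rule inj_onI)
    fix K K' assume K: "K \<in> ?F" "K' \<in> ?F" "\<mu> K = \<mu> K'"
    then obtain X X' where X: "X \<subseteq> pre i" "X' \<subseteq> pre i" "K = residual \<S> i X" "K' = residual \<S> i X'"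
      by auto
    show "K = K'"
      using transfer[OF X(1,2)] transfer[OF X(2,1)] K unfolding X(3,4) by (intro equalityI) simp_all
  qed
  have range: "\<mu> ` ?F \<subseteq> {rank \<I> E - rank \<I> (pre i)..rank \<I> (E - pre i)}"
  proof
    fix k assume "k \<in> \<mu> ` ?F"
    then obtain X where X: "X \<subseteq> pre i" "residual \<S> i X \<in> ?F" "k = \<mu> (residual \<S> i X)" by auto
    obtain Z where Z: "Z \<in> residual \<S> i X" "card Z = k"
      using att[OF X(2)] X(3) by blast
    have ZI: "X \<union> Z \<in> \<I>" "Z \<subseteq> E - pre i" using Z(1) SI[of "X \<union> Z"] by (auto simp: residual_def)
    then have "card Z \<le> rank \<I> (E - pre i)"
      using indep_hereditary[of "X \<union> Z" Z] by (intro card_le_rank) auto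
    moreover have "rank \<I> E - rank \<I> (pre i) \<le> k"
    proof -
      have "X \<in> \<I>" using ZI indep_hereditary[of "X \<union> Z" X] by auto
      \<comment> \<open>A basis extending \<open>X\<close> leaves a completion of size at least
        \<open>rank \<I> E - rank \<I> (pre i)\<close>. If the residual is taken in
        \<open>bases \<I>\<close>, then \<open>X \<union> Z\<close> itself is such a basis.\<close>
      obtain B where B: "B \<in> \<I>" "X \<subseteq> B" "card B = rank \<I> E" "\<S> = \<I> \<or> B = X \<union> Z"
      proof (cases "\<S> = \<I>")
        case True
        then show ?thesis
          using extend_to_rank[OF \<open>X \<in> \<I>\<close>, of E] indep_subset_ground[OF \<open>X \<in> \<I>\<close>] that by blast
      next
        case False
        then have "X \<union> Z \<in> bases \<I>" using S Z by (auto simp: residual_def)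
        then show ?thesis using that[of "X \<union> Z"] bases_iff by auto
      qed
      have "B - pre i \<in> residual \<S> i X"
        using B(4)
      proof
        assume "\<S> = \<I>"
        moreover have "X \<union> (B - pre i) \<in> \<I>"
          by (rule indep_hereditary[OF B(1)]) (use B(2) in auto)
        ultimately show ?thesis
          using indep_subset_ground[OF B(1)] by (auto simp: residual_def)
      next
        assume "B = X \<union> Z"
        then have "B - pre i = Z" using X(1) ZI(2) by auto
        then show ?thesis using Z by simp
      qed
      then have "card (B - pre i) \<le> k" using ub[OF X(2)] X(3) by simp
      moreover have "card (B \<inter> pre i) \<le> rank \<I> (pre i)"
        using indep_hereditary[OF B(1)] by (intro card_le_rank) auto
      moreover have "card (B - pre i) + card (B \<inter> pre i) = card B"
        using finite_indep[OF B(1)] by (rule card_Diff_plus_card_Int)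
      ultimately show ?thesis using B(3) by linarith
    qed
    ultimately show "k \<in> {rank \<I> E - rank \<I> (pre i)..rank \<I> (E - pre i)}"
      using Z(2) by simp
  qed
  have "card ?F = card (\<mu> ` ?F)" using card_image[OF inj] by simp
  also have "\<dots> \<le> card {rank \<I> E - rank \<I> (pre i)..rank \<I> (E - pre i)}"
    using range by (intro card_mono) auto
  \<comment> \<open>The interval has \<open>connectivity E \<I> (pre i) + 1\<close> elements because
    neither subtraction truncates.\<close>
  also have "\<dots> \<le> connectivity E \<I> (pre i) + 1"
    using rank_subadditive[OF pre_subset, of i] rank_le_rank_ground[of "pre i"]
    by (simp add: connectivity_def)
  finally show ?thesis .
qed

section \<open>Connectivity of prefixes and of arbitrary sets\<close>

lemma connectivity_pre_le: "connectivity E \<I> (pre i) \<le> card (pre (rank \<I> E) - G)"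
proof -
  let ?r = "rank \<I> E"
  have split: "card (pre j) = card (pre j - G) + card (G \<inter> pre j)" for j
    using card_Diff_plus_card_Int[of "pre j" G] by (simp add: Int_commute)
  have r: "?r \<le> card E" using rank_le_card[OF finite_ground] .
  \<comment> \<open>By \<open>rank_suffix\<close> the connectivity of a prefix is the excess of its
    rank over the size of its part of \<open>G\<close>.\<close>
  have conn: "connectivity E \<I> (pre i) = rank \<I> (pre i) - card (G \<inter> pre i)"
    using rank_suffix[of i] by (simp add: connectivity_def)
  show ?thesis
  \<comment> \<open>Up to length \<open>?r\<close> the excess is at most
    \<open>card (pre i - G)\<close>, which grows with \<open>i\<close>; beyond that the rank is at
    most \<open>?r\<close> while the part of \<open>G\<close> does not shrink.\<close>
  proof (cases "i \<le> ?r")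
    case True
    have "card (pre i - G) \<le> card (pre ?r - G)"
      using pre_mono[OF True] by (intro card_mono) auto
    then show ?thesis
      using conn rank_le_card[OF finite_pre, of i] split[of i] by linarith
  next
    case False
    have "card (G \<inter> pre ?r) \<le> card (G \<inter> pre i)"
      using pre_mono[of ?r i] False finite_G by (intro card_mono) auto
    moreover have "card (pre ?r) = ?r" using r card_pre by simp
    ultimately show ?thesis
      using conn rank_le_rank_ground[of "pre i"] split[of ?r] by linarith
  qed
qed

text \<open>A set with exactly half of the symmetric difference of \<open>G\<close> and the prefix
  of length \<open>rank \<I> E\<close> leaves the other half to its complement. Each half is
  independent together with the common part, as in the uniform minor, so the two ranks exceed
  \<open>rank \<I> E\<close> by at least the size of a half.\<close>

lemma connectivity_ge:
  assumes P: "P \<subseteq> E" and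
    bal: "card (P \<inter> ((pre (rank \<I> E) - G) \<union> (G - pre (rank \<I> E)))) = card (pre (rank \<I> E) - G)"
  shows "card (pre (rank \<I> E) - G) \<le> connectivity E \<I> P"
proof -
  let ?r = "rank \<I> E"
  let ?Q = "pre ?r"
  let ?Z = "(?Q - G) \<union> (G - ?Q)"
  let ?W = "G \<inter> ?Q"
  define k where "k = card (?Q - G)"
  have GE: "G \<subseteq> E" using G_basis bases_iff indep_subset_ground by blast
  have "card ?Q = ?r" using rank_le_card[OF finite_ground] card_pre by simp
  moreover have "card ?Q = k + card ?W"
    using card_Diff_plus_card_Int[of ?Q G] by (simp add: Int_commute k_def)
  moreover have "card G = card (G - ?Q) + card ?W"
    using card_Diff_plus_card_Int[OF finite_G] by simp
  ultimately have W: "k + card ?W = ?r" and k2: "card (G - ?Q) = k"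
    using card_G by auto
  have finZ: "finite ?Z" using finite_G by simp
  have cardZ: "card ?Z = 2 * k"
    using k2 finite_G unfolding k_def by (subst card_Un_disjoint) auto
  have uniform: "V \<union> ?W \<in> \<I>" if V: "V \<subseteq> ?Z" "card V = k" for V
    unfolding indep_iff
  proof (intro conjI allI)
    show "V \<union> ?W \<subseteq> E" using V GE pre_subset by blast
    fix j
    have finV: "finite V" using V finZ finite_subset by blast
    show "card (V \<union> ?W - pre j) \<le> rank \<I> (E - pre j)"
    \<comment> \<open>Beyond \<open>pre j\<close> with \<open>j \<ge> ?r\<close> only elements of
      \<open>G\<close> remain; for \<open>j < ?r\<close> the set has \<open>?r\<close> elements and
      contains all of \<open>G \<inter> pre j\<close>.\<close>
    proof (cases "?r \<le> j")
      case True
      then have "V \<union> ?W - pre j \<subseteq> G - pre j"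
        using V pre_mono by blast
      then show ?thesis
        using card_mono[of "G - pre j"] finite_G card_G_diff_pre by simp
    next
      case False
      have "card (V \<union> ?W) = k + card ?W"
        using V finV by (subst card_Un_disjoint) auto
      moreover have "card (V \<union> ?W - pre j) + card ((V \<union> ?W) \<inter> pre j) = card (V \<union> ?W)"
        by (rule card_Diff_plus_card_Int) (use finV in simp)
      moreover have "card (G \<inter> pre j) \<le> card ((V \<union> ?W) \<inter> pre j)"
        using False pre_mono[of j ?r] by (intro card_mono) auto
      ultimately show ?thesis using rank_suffix[of j] W by linarith
    qed
  qed
  have part: "k + card (?W \<inter> T) \<le> rank \<I> T" if T: "card (T \<inter> ?Z) = k" for T
  proof -
    have "(T \<inter> ?Z) \<union> ?W \<in> \<I>" using uniform[of "T \<inter> ?Z"] T by auto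
    then have "(T \<inter> ?Z) \<union> (?W \<inter> T) \<in> \<I>" by (rule indep_hereditary) blast
    then have "card ((T \<inter> ?Z) \<union> (?W \<inter> T)) \<le> rank \<I> T" by (intro card_le_rank) auto
    moreover have "card ((T \<inter> ?Z) \<union> (?W \<inter> T)) = k + card (?W \<inter> T)"
      using T finZ by (subst card_Un_disjoint) auto
    ultimately show ?thesis by simp
  qed
  have "(E - P) \<inter> ?Z = ?Z - P \<inter> ?Z" using GE pre_subset by blast
  then have "card ((E - P) \<inter> ?Z) = k"
    using cardZ bal finZ by (simp add: card_Diff_subset k_def)
  then have "k + card (?W \<inter> (E - P)) \<le> rank \<I> (E - P)" by (rule part)
  moreover have "k + card (?W \<inter> P) \<le> rank \<I> P" by (rule part) (use bal k_def in simp)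
  \<comment> \<open>The elements of \<open>?W\<close> are divided between \<open>P\<close> and its
    complement, while \<open>k\<close> is counted on both sides.\<close>
  moreover have "card ?W = card (?W \<inter> P) + card (?W \<inter> (E - P))"
  proof -
    have "?W = (?W \<inter> P) \<union> (?W \<inter> (E - P))" using GE by blast
    then show ?thesis
      by (subst card_Un_disjoint[symmetric]) auto
  qed
  ultimately show ?thesis
    using W unfolding connectivity_def k_def[symmetric] by linarith
qed

end

section \<open>Left-justified orders and pathwidth\<close>

lemma sorted_wrt_unique:
  assumes "antisym R" "sorted_wrt (\<lambda>x y. (x, y) \<in> R) xs" "sorted_wrt (\<lambda>x y. (x, y) \<in> R) ys"
    "distinct xs" "distinct ys" "set xs = set ys"
  shows "xs = ys"
  using assms(2-)
proof (induction xs arbitrary: ys)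
  case (Cons x xs)
  then obtain y zs where ys: "ys = y # zs" by (cases ys) auto
  have "x = y"
  proof (rule ccontr)
    assume "x \<noteq> y"
    then have "x \<in> set zs" "y \<in> set xs" using Cons.prems(5) ys by auto
    then have "(y, x) \<in> R" "(x, y) \<in> R" using Cons.prems(1,2) ys by auto
    with \<open>x \<noteq> y\<close> assms(1) show False by (auto dest: antisymD)
  qed
  moreover have "set xs = set zs"
    using Cons.prems ys \<open>x = y\<close> by auto
  ultimately show ?case using Cons.IH[of zs] Cons.prems ys by simp
qed simp

lemma ex_increasing_list:
  assumes lin: "linear_order_on E R" and "finite X" "X \<subseteq> E"
  shows "\<exists>xs. distinct xs \<and> set xs = X \<and> sorted_wrt (\<lambda>x y. (x, y) \<in> R) xs"
  using assms(2,3)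
proof (induction X rule: finite_induct)
  case (insert x F)
  then obtain xs where xs: "distinct xs" "set xs = F" "sorted_wrt (\<lambda>x y. (x, y) \<in> R) xs"
    by auto
  let ?l = "filter (\<lambda>y. (y, x) \<in> R) xs" and ?u = "filter (\<lambda>y. (y, x) \<notin> R) xs"
  have total: "(x, y) \<in> R" if "y \<in> F" "(y, x) \<notin> R" for y
    using lin insert.prems insert.hyps that by (auto simp: order_on_defs total_on_def)
  have trans: "trans R" using lin by (simp add: order_on_defs)
  have "sorted_wrt (\<lambda>x y. (x, y) \<in> R) (?l @ x # ?u)"
    using xs total transD[OF trans]
    by (auto simp: sorted_wrt_append sorted_wrt_filter)
  moreover have "distinct (?l @ x # ?u)" "set (?l @ x # ?u) = insert x F"
    using xs insert.hyps by auto
  ultimately show ?case by blast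
qed simp

lemma increasing_list:
  assumes "linear_order_on E R" "finite X" "X \<subseteq> E"
  shows distinct_increasing_list: "distinct (increasing_list R X)"
    and set_increasing_list: "set (increasing_list R X) = X"
    and sorted_increasing_list: "sorted_wrt (\<lambda>x y. (x, y) \<in> R) (increasing_list R X)"
    and length_increasing_list: "length (increasing_list R X) = card X"
proof -
  have anti: "antisym R" using assms(1) by (simp add: order_on_defs)
  have "\<exists>!xs. distinct xs \<and> set xs = X \<and> sorted_wrt (\<lambda>x y. (x, y) \<in> R) xs"
    using ex_increasing_list[OF assms] sorted_wrt_unique[OF anti] by (metis (no_types, lifting))
  from theI'[OF this] have *: "distinct (increasing_list R X) \<and> set (increasing_list R X) = X \<and>
      sorted_wrt (\<lambda>x y. (x, y) \<in> R) (increasing_list R X)"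
    unfolding increasing_list_def .
  then show "distinct (increasing_list R X)" "set (increasing_list R X) = X"
    "sorted_wrt (\<lambda>x y. (x, y) \<in> R) (increasing_list R X)" by auto
  with * show "length (increasing_list R X) = card X" using distinct_card by metis
qed

section \<open>The Gale order through prefix counts\<close>

lemma down_set_eq_take:
  assumes lin: "linear_order_on E R" and "finite E" and x: "x \<in> E"
  shows "\<exists>i. {y. (y, x) \<in> R} = set (take i (increasing_list R E))"
proof -
  let ?es = "increasing_list R E"
  note es = increasing_list[OF lin \<open>finite E\<close> order_refl]
  have R: "R \<subseteq> E \<times> E" "antisym R" "refl_on E R" using lin by (auto simp: order_on_defs)
  obtain m where m: "m < length ?es" "?es ! m = x"
    using x es(2) by (metis in_set_conv_nth)
  \<comment> \<open>The element at index \<open>m\<close> belongs to its own down-set, which is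
    therefore the prefix of length \<open>Suc m\<close>.\<close>
  have nth: "(?es ! l, x) \<in> R \<longleftrightarrow> l < Suc m" if l: "l < length ?es" for l
  proof (cases l m rule: linorder_cases)
    case less
    then show ?thesis using sorted_wrt_nth_less[OF es(3) less] m by auto
  next
    case equal
    then show ?thesis using R(3) m x by (auto simp: refl_on_def)
  next
    case greater
    then have "(x, ?es ! l) \<in> R" using sorted_wrt_nth_less[OF es(3) greater] m l by auto
    moreover have "?es ! l \<noteq> x" using nth_eq_iff_index_eq[OF es(1) l m(1)] m greater by auto
    ultimately show ?thesis using R(2) greater by (auto dest: antisymD)
  qed
  have "{y. (y, x) \<in> R} = set (take (Suc m) ?es)"
  proof (intro set_eqI iffI)
    fix y assume "y \<in> {y. (y, x) \<in> R}"
    then have yx: "(y, x) \<in> R" by simp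
    then have "y \<in> set ?es" using R(1) unfolding es(2) by blast
    then obtain l where l: "l < length ?es" "?es ! l = y" by (auto simp: in_set_conv_nth)
    then have "l < Suc m" using nth[OF l(1)] yx by simp
    then have "take (Suc m) ?es ! l = y" "l < length (take (Suc m) ?es)" using l by auto
    then show "y \<in> set (take (Suc m) ?es)" by (metis nth_mem)
  next
    fix y assume "y \<in> set (take (Suc m) ?es)"
    then obtain l where "l < Suc m" "l < length ?es" "?es ! l = y"
      by (auto simp: in_set_conv_nth)
    then show "y \<in> {y. (y, x) \<in> R}" using nth[of l] by simp
  qed
  then show ?thesis by blast
qed

text \<open>If the \<open>j\<close>-th element of \<open>B'\<close>, counting from 0, were not below
  the \<open>j\<close>-th of \<open>B\<close>, the down-set of the latter would hold more than
  \<open>j\<close> elements of \<open>B\<close> but at most \<open>j\<close> of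
  \<open>B'\<close>.\<close>

lemma gale_le_if_prefix_cards_le:
  assumes lin: "linear_order_on E R" and fin: "finite E" and sub: "B \<subseteq> E" "B' \<subseteq> E"
    and card: "card B' = card B"
    and le: "\<And>i. card (B \<inter> set (take i (increasing_list R E)))
      \<le> card (B' \<inter> set (take i (increasing_list R E)))"
  shows "gale_le R B' B"
proof -
  let ?xs = "increasing_list R B'" and ?ys = "increasing_list R B"
  have finB: "finite B" "finite B'" using sub fin finite_subset by auto
  note xs = increasing_list[OF lin finB(2) sub(2)]
  note ys = increasing_list[OF lin finB(1) sub(1)]
  have R: "antisym R" "refl_on E R" "trans R" "total_on E R" using lin by (auto simp: order_on_defs)
  have "(?xs ! j, ?ys ! j) \<in> R" if j: "j < card B" for j
  proof (rule ccontr)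
    assume notin: "(?xs ! j, ?ys ! j) \<notin> R"
    let ?D = "{y. (y, ?ys ! j) \<in> R}"
    have inE: "?ys ! j \<in> E" "?xs ! j \<in> E"
      using j xs(2,4) ys(2,4) sub card nth_mem by (metis subsetD)+
    have "?ys ! l \<in> B \<inter> ?D" if "l < Suc j" for l
    proof (cases "l = j")
      case True
      then show ?thesis using inE R(2) ys j by (metis IntI mem_Collect_eq nth_mem refl_on_def)
    next
      case False
      then have "l < j" using that by simp
      then show ?thesis
        using sorted_wrt_nth_less[OF ys(3)] ys(2,4) j
        by (metis (mono_tags, lifting) IntI mem_Collect_eq nth_mem order_less_trans)
    qed
    then have "(\<lambda>l. ?ys ! l) ` {..<Suc j} \<subseteq> B \<inter> ?D" by auto
    then have "card ((\<lambda>l. ?ys ! l) ` {..<Suc j}) \<le> card (B \<inter> ?D)"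
      using finB by (intro card_mono) auto
    moreover have "card ((\<lambda>l. ?ys ! l) ` {..<Suc j}) = Suc j"
      using inj_on_nth[OF ys(1), of "{..<Suc j}"] j ys(4) by (subst card_image) auto
    moreover have "card (B \<inter> ?D) \<le> card (B' \<inter> ?D)"
      using down_set_eq_take[OF lin fin inE(1)] le by auto
    moreover have "B' \<inter> ?D \<subseteq> (\<lambda>l. ?xs ! l) ` {..<j}"
    proof
      fix z assume z: "z \<in> B' \<inter> ?D"
      then obtain l where l: "l < length ?xs" "z = ?xs ! l"
        using xs(2) by (metis IntD1 in_set_conv_nth)
      have "l < j"
      proof (rule ccontr)
        assume "\<not> l < j"
        then have "(?xs ! j, z) \<in> R"
          using sorted_wrt_nth_less[OF xs(3), of j l] l inE(2) R(2)
          by (cases "l = j") (auto simp: refl_on_def)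
        then have "(?xs ! j, ?ys ! j) \<in> R" using z transD[OF R(3)] by blast
        with notin show False ..
      qed
      with l show "z \<in> (\<lambda>l. ?xs ! l) ` {..<j}" by auto
    qed
    then have "card (B' \<inter> ?D) \<le> j"
      using surj_card_le[of "{..<j}"] by fastforce
    ultimately show False by linarith
  qed
  then show ?thesis
    unfolding gale_le_def list_all2_conv_all_nth using xs(4) ys(4) card by simp
qed

lemma gale_le_trans:
  assumes "trans R" "gale_le R X Y" "gale_le R Y Z"
  shows "gale_le R X Z"
  unfolding gale_le_def
  by (rule list_all2_trans[OF _ assms(2,3)[unfolded gale_le_def]]) (rule transD[OF assms(1)])

text \<open>A set Gale-below a basis is Gale-below the Gale basis by transitivity, and
  left-justification makes it a basis.\<close>

lemma shifted_if_left_justified: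
  assumes "matroid E \<I>" and lj: "left_justified_order E \<I> R"
  shows "shifted_matroid E \<I> (increasing_list R E)"
proof -
  interpret matroid E \<I> by fact
  have lin: "linear_order_on E R" using lj by (simp add: left_justified_order_def)
  note es = increasing_list[OF lin finite_ground order_refl]
  show ?thesis
  proof
    fix B B' assume h: "B \<in> bases \<I>" "B' \<subseteq> E" "card B' = card B"
      "\<And>i. card (B \<inter> set (take i (increasing_list R E)))
        \<le> card (B' \<inter> set (take i (increasing_list R E)))"
    have B: "B \<subseteq> E" "card B = rank \<I> E"
      using h(1) bases_iff indep_subset_ground by auto
    have "gale_le R B (gale_basis \<I> R)"
      using lj B h(1) by (simp add: left_justified_order_def)
    moreover have "gale_le R B' B"
      by (rule gale_le_if_prefix_cards_le[OF lin finite_ground B(1) h(2,3)]) (rule h(4))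
    moreover have "trans R" using lin by (simp add: order_on_defs)
    ultimately have "gale_le R B' (gale_basis \<I> R)" using gale_le_trans by metis
    then show "B' \<in> bases \<I>"
      using lj B h(2,3) by (simp add: left_justified_order_def)
  qed (use es in auto)
qed

section \<open>Lower bound on the pathwidth\<close>

context shifted_matroid
begin

text \<open>Discrete intermediate value argument: along any order the number of elements of
  \<open>?Z\<close> in the prefix starts at 0, grows by at most 1 and ends at \<open>?k\<close> or
  more, so some prefix contains exactly \<open>?k\<close>.\<close>

lemma order_connectivity_ge:
  assumes lin: "linear_order_on E R"
  shows "card (pre (rank \<I> E) - G) \<le> order_connectivity E \<I> R"
proof (cases "card (pre (rank \<I> E) - G) = 0")
  case False
  let ?k = "card (pre (rank \<I> E) - G)"
  let ?Z = "(pre (rank \<I> E) - G) \<union> (G - pre (rank \<I> E))"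
  let ?fs = "increasing_list R E"
  note fs = increasing_list[OF lin finite_ground order_refl]
  define f where "f i = card (set (take i ?fs) \<inter> ?Z)" for i
  have "?Z \<subseteq> E" using pre_subset G_basis bases_iff indep_subset_ground by blast
  then have "f (card E) = card ?Z" using fs by (simp add: f_def Int_absorb1)
  also have "\<dots> \<ge> ?k" using finite_G by (intro card_mono) auto
  finally have top: "?k \<le> f (card E)" .
  define i where "i = (LEAST i. ?k \<le> f i)"
  have i: "?k \<le> f i" "i \<le> card E"
    unfolding i_def using top by (auto intro: LeastI Least_le)
  have "f 0 = 0" by (simp add: f_def)
  \<comment> \<open>The maximum in \<open>order_connectivity\<close> starts at prefixes of length 1;
    positive \<open>?k\<close> keeps the chosen prefix nonempty.\<close>
  then have "i \<noteq> 0" using i(1) False by (metis le_zero_eq)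
  then obtain j where j: "i = Suc j" using not0_implies_Suc by blast
  have "f j < ?k" using not_less_Least[of j "\<lambda>i. ?k \<le> f i"] j i_def by (simp add: not_le)
  moreover have "f i \<le> Suc (f j)"
  proof -
    have "set (take i ?fs) \<inter> ?Z \<subseteq> insert (?fs ! j) (set (take j ?fs) \<inter> ?Z)"
      using i(2) fs(4) j by (auto simp: take_Suc_conv_app_nth)
    then have "f i \<le> card (insert (?fs ! j) (set (take j ?fs) \<inter> ?Z))"
      unfolding f_def by (intro card_mono) auto
    also have "\<dots> \<le> Suc (f j)" unfolding f_def by (rule card_insert_le_m1) auto
    finally show ?thesis .
  qed
  ultimately have "f i = ?k" using i(1) by simp
  moreover have "set (take i ?fs) \<subseteq> E" using fs(2) set_take_subset by metis
  ultimately have "?k \<le> connectivity E \<I> (set (take i ?fs))"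
    by (intro connectivity_ge) (auto simp: f_def)
  also have "\<dots> \<le> order_connectivity E \<I> R"
    unfolding order_connectivity_def using i(2) \<open>i \<noteq> 0\<close> by (intro Max_ge) auto
  finally show ?thesis .
qed linarith

lemma connectivity_pre_le_pathwidth:
  assumes "linear_order_on E R"
  shows "connectivity E \<I> (pre i) \<le> pathwidth E \<I>"
proof -
  have "{R. linear_order_on E R} \<subseteq> Pow (E \<times> E)" by (auto simp: order_on_defs)
  then have "finite {R. linear_order_on E R}" using finite_ground finite_subset by blast
  then have "card (pre (rank \<I> E) - G) \<le> pathwidth E \<I>"
    unfolding pathwidth_def using assms order_connectivity_ge by (subst Min_ge_iff) auto
  then show ?thesis using connectivity_pre_le[of i] by simp
qed

end

section \<open>Reduced decision diagrams\<close>

text \<open>BDD reduction is the case \<open>z = False\<close>, ZDD reduction the case \<open>z = True\<close>.\<close>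

inductive reduction_step :: "bool \<Rightarrow> ('n, 'a) diagram \<Rightarrow> ('n, 'a) diagram \<Rightarrow> bool" for z where
  merge: "\<lbrakk>u \<in> inner D; v \<in> inner D; u \<noteq> v; lab D u = lab D v;
     succ0 D u = succ0 D v; succ1 D u = succ1 D v\<rbrakk>
     \<Longrightarrow> reduction_step z D (remove_node v (Inner u) D)"
| delete: "\<lbrakk>v \<in> inner D; succ1 D v = (if z then Bot else succ0 D v)\<rbrakk>
     \<Longrightarrow> reduction_step z D (remove_node v (succ0 D v) D)"

lemma bdd_step_eq: "bdd_step = reduction_step False"
  by (intro ext iffI)
    (auto elim!: bdd_step.cases reduction_step.cases
      intro: bdd_merge bdd_delete merge delete[where z = False, simplified])

lemma zdd_step_eq: "zdd_step = reduction_step True"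
  by (intro ext iffI)
    (auto elim!: zdd_step.cases reduction_step.cases
      intro: zdd_merge zdd_delete merge delete[where z = True, simplified])

section \<open>Vertices that represent subfunctions of the tree\<close>

locale decision_family =
  fixes es :: "'a list" and \<S> :: "'a set set" and z :: bool
  assumes distinct_elems: "distinct es"
begin

definition accepts :: "bool list \<Rightarrow> bool" where
  "accepts p \<longleftrightarrow> {es ! i | i. i < length es \<and> p ! i} \<in> \<S>"

text \<open>What \<open>x\<close> computes when reached by an arc into depth \<open>k\<close>: the levels skipped between depth
  \<open>k\<close> and \<open>x\<close> are irrelevant for BDDs and must be left by 0-arcs for ZDDs.\<close>

fun computes :: "bool list vertex \<Rightarrow> nat \<Rightarrow> bool list \<Rightarrow> bool" where
  "computes Bot k s \<longleftrightarrow> False"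
| "computes Top k s \<longleftrightarrow> (z \<longrightarrow> True \<notin> set s)"
| "computes (Inner w) k s \<longleftrightarrow>
     (z \<longrightarrow> True \<notin> set (take (length w - k) s)) \<and> accepts (w @ drop (length w - k) s)"

lemma computes_if_Bot: "computes (if c then Bot else x) k s \<longleftrightarrow> \<not> c \<and> computes x k s"
  by simp

text \<open>The meaning of \<open>Inner w\<close> is that of the tree node \<open>w\<close>, not
  that of its current arcs, so it does not change while the diagram is reduced. The length bounds
  let an arc skip levels downwards.\<close>

definition represents :: "bool list vertex \<Rightarrow> bool list \<Rightarrow> bool" where
  "represents x q \<longleftrightarrow>
     (\<forall>w. x = Inner w \<longrightarrow> length q \<le> length w \<and> length w < length es) \<and>
     (\<forall>s. length q + length s = length es \<longrightarrow>
        accepts (q @ s) = computes x (length q) s)"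

lemma represents_Inner_lengths:
  "represents (Inner w) q \<Longrightarrow> length q \<le> length w \<and> length w < length es"
  by (simp add: represents_def)

lemma accepts_eq_computes:
  "represents x q \<Longrightarrow> length q + length s = length es \<Longrightarrow> accepts (q @ s) = computes x (length q) s"
  by (simp add: represents_def)

lemma represents_self: "length q < length es \<Longrightarrow> represents (Inner q) q"
  by (simp add: represents_def)

lemma represents_tree_vertex: "length q \<le> length es \<Longrightarrow> represents (tree_vertex es \<S> q) q"
  by (auto simp: tree_vertex_def represents_def accepts_def)

lemma represents_cong:
  assumes "represents x q'" "length q = length q'"
    "\<And>s. length q + length s = length es \<Longrightarrow> accepts (q @ s) = accepts (q' @ s)"
  shows "represents x q"
  using assms by (simp add: represents_def)

lemma represents_same:
  assumes "represents x q" "represents x q'" "length q = length q'"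
    "length q + length s = length es"
  shows "accepts (q @ s) = accepts (q' @ s)"
  using assms by (simp add: represents_def)

text \<open>The bits \<open>t\<close> concern levels above \<open>x\<close>, hence skipped ones:
  irrelevant for BDDs, all 0 for ZDDs.\<close>

lemma computes_append:
  assumes "\<And>w. x = Inner w \<Longrightarrow> k + length t \<le> length w"
  shows "computes x k (t @ s) \<longleftrightarrow> (z \<longrightarrow> True \<notin> set t) \<and> computes x (k + length t) s"
proof (cases x)
  case (Inner w)
  then have "length w - k = length t + (length w - (k + length t))" using assms by simp
  then show ?thesis using Inner by auto
qed auto

text \<open>Justifies redirecting an arc: the levels skipped before \<open>v\<close> and those
  skipped between \<open>v\<close> and \<open>x\<close> add up to one skip.\<close>

lemma represents_trans:
  assumes v: "represents (Inner v) q" and x: "represents x v"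
  shows "represents x q"
proof -
  define d where "d = length v - length q"
  have len: "length v = length q + d" "length v < length es"
    using represents_Inner_lengths[OF v] by (auto simp: d_def)
  have lw: "length v \<le> length w" "length w < length es" if "x = Inner w" for w
    using x that by (auto simp: represents_def)
  have "accepts (q @ s) = computes x (length q) s" if s: "length q + length s = length es" for s
  proof -
    have "accepts (q @ s) \<longleftrightarrow> (z \<longrightarrow> True \<notin> set (take d s)) \<and> accepts (v @ drop d s)"
      using accepts_eq_computes[OF v s] by (simp add: d_def)
    moreover have "accepts (v @ drop d s) = computes x (length v) (drop d s)"
      using s len by (intro accepts_eq_computes[OF x]) simp
    moreover have "length (take d s) = d" using s len by simp
    ultimately show ?thesis
      using computes_append[of x "length q" "take d s" "drop d s"] lw len by simp
  qed
  moreover have "length q \<le> length w" if "x = Inner w" for w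
    using lw(1)[OF that] len(1) by simp
  ultimately show ?thesis
    unfolding represents_def using lw(2) by blast
qed

text \<open>Equal successors give equal values after either next bit, so \<open>u\<close> and
  \<open>v\<close> have the same subfunction.\<close>

lemma represents_merge:
  assumes "length u = length v" "length v < length es"
    and "represents x0 (u @ [False])" "represents x0 (v @ [False])"
    and "represents x1 (u @ [True])" "represents x1 (v @ [True])"
  shows "represents (Inner u) v"
proof (rule represents_cong[OF represents_self])
  fix s :: "bool list" assume s: "length v + length s = length es"
  then obtain b t where bt: "s = b # t" using assms(2) by (cases s) auto
  show "accepts (v @ s) = accepts (u @ s)"
    using represents_same[OF assms(4,3), of t] represents_same[OF assms(6,5), of t] assms(1) s bt
    by (cases b) simp_all
qed (use assms in simp_all)

text \<open>The vertex \<open>if z then Bot else x\<close> on the 1-arc states both deletion rules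
  at once; under it the level of \<open>v\<close> behaves as a skipped level.\<close>

lemma represents_delete:
  assumes v: "length v < length es"
    and x: "represents x (v @ [False])" and y: "represents (if z then Bot else x) (v @ [True])"
  shows "represents x v"
proof -
  have lw: "length v < length w" "length w < length es" if "x = Inner w" for w
    using x that by (auto simp: represents_def)
  have "accepts (v @ s) = computes x (length v) s" if s: "length v + length s = length es" for s
  proof -
    obtain b t where bt: "s = b # t" using v s by (cases s) auto
    have "computes x (length v) s \<longleftrightarrow> \<not> (z \<and> b) \<and> computes x (Suc (length v)) t"
      using computes_append[of x "length v" "[b]" t] lw bt by (auto simp: Suc_le_eq)
    then show ?thesis
      using accepts_eq_computes[OF x, of t] accepts_eq_computes[OF y, of t] s bt
      by (cases b) (simp_all add: computes_if_Bot)
  qed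
  then show ?thesis unfolding represents_def using lw less_imp_le by blast
qed

text \<open>Converse of \<open>represents_delete\<close>: a vertex that skips the level of
  \<open>v\<close> represents the children of \<open>v\<close> in the pattern of a deletable
  node.\<close>

lemma represents_skip:
  assumes x: "represents x v" and lw: "\<And>w. x = Inner w \<Longrightarrow> length v < length w"
  shows "represents (if z then Bot else x) (v @ [True])"
    and "represents x (v @ [False])"
proof -
  have step: "accepts (v @ b # t) \<longleftrightarrow> \<not> (z \<and> b) \<and> computes x (Suc (length v)) t"
    if t: "Suc (length v + length t) = length es" for b t
    using accepts_eq_computes[OF x, of "b # t"] computes_append[of x "length v" "[b]" t] lw t
    by (auto simp: Suc_le_eq)
  have lw': "Suc (length v) \<le> length w \<and> length w < length es" if "x = Inner w" for w
    using lw[OF that] x that by (simp add: represents_def Suc_le_eq)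
  show "represents (if z then Bot else x) (v @ [True])" "represents x (v @ [False])"
    unfolding represents_def
    by (auto simp: computes_if_Bot step lw' split: if_splits)
qed

text \<open>Lets two representatives be compared at the shallower one: the path of zeros from
  \<open>q\<close> reaches its depth, and both rules allow zeros on skipped levels.\<close>

lemma represents_descend:
  assumes w: "represents (Inner w) q" and x: "represents x q"
    and lw: "\<And>w'. x = Inner w' \<Longrightarrow> length w \<le> length w'"
  shows "represents x w"
proof -
  define d where "d = length w - length q"
  have len: "length w = length q + d" "length w < length es"
    using represents_Inner_lengths[OF w] by (auto simp: d_def)
  have "accepts (w @ s) = computes x (length w) s" if s: "length w + length s = length es" for s
  proof -
    let ?s = "replicate d False @ s"
    have l: "length q + length ?s = length es" using s len by simp
    have "accepts (q @ ?s) \<longleftrightarrow> accepts (w @ s)"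
      using accepts_eq_computes[OF w l] by (simp add: d_def)
    then show ?thesis
      using accepts_eq_computes[OF x l] computes_append[of x "length q" "replicate d False" s] lw len
      by simp
  qed
  moreover have "length w' < length es" if "x = Inner w'" for w'
    using x that by (simp add: represents_def)
  ultimately show ?thesis unfolding represents_def using lw by blast
qed

section \<open>Invariance under reduction steps\<close>

definition valid :: "(bool list, 'a) diagram \<Rightarrow> bool list vertex \<Rightarrow> bool" where
  "valid D x \<longleftrightarrow> (\<forall>w. x = Inner w \<longrightarrow> w \<in> inner D)"

text \<open>Invariant of the reduction: labels still tell the depth, no arc leads to a removed node,
  and every arc represents the tree node it led to originally.\<close>

definition represents_subfunctions :: "(bool list, 'a) diagram \<Rightarrow> bool" where
  "represents_subfunctions D \<longleftrightarrow> (\<forall>p\<in>inner D. length p < length es \<and> lab D p = es ! length p \<and>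
     valid D (succ0 D p) \<and> valid D (succ1 D p) \<and>
     represents (succ0 D p) (p @ [False]) \<and> represents (succ1 D p) (p @ [True]))"

lemma represents_subfunctions_remove:
  assumes D: "represents_subfunctions D" and v: "v \<in> inner D" and "represents x v"
    and "valid D x" "x \<noteq> Inner v"
  shows "represents_subfunctions (remove_node v x D)"
proof -
  have "valid (remove_node v x D) (redirect v x y)" if "valid D y" for y
    using that assms by (auto simp: valid_def redirect_def remove_node_def)
  moreover have "represents (redirect v x y) q" if "represents y q" for y q
    using that assms(3) represents_trans by (auto simp: redirect_def)
  ultimately show ?thesis
    using D by (auto simp: represents_subfunctions_def remove_node_def)
qed

lemma represents_subfunctions_step:
  assumes "reduction_step z D D'" and D: "represents_subfunctions D"
  shows "represents_subfunctions D'"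
  using assms(1)
proof cases
  case (merge u v)
  have node: "length p < length es" "lab D p = es ! length p"
    "represents (succ0 D p) (p @ [False])" "represents (succ1 D p) (p @ [True])"
    if "p \<in> inner D" for p
    using that D by (auto simp: represents_subfunctions_def)
  note u = node[OF \<open>u \<in> inner D\<close>] and v = node[OF \<open>v \<in> inner D\<close>]
  have "length u = length v"
    using u(1,2) v(1,2) merge distinct_elems by (simp add: nth_eq_iff_index_eq)
  then have "represents (Inner u) v"
    using represents_merge[OF _ v(1), of u "succ0 D u" "succ1 D u"] u(3,4) v(3,4) merge by simp
  then show ?thesis
    using represents_subfunctions_remove[OF D] merge by (simp add: valid_def)
next
  case (delete v)
  have v: "length v < length es" "valid D (succ0 D v)" "represents (succ0 D v) (v @ [False])"
    "represents (succ1 D v) (v @ [True])"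
    using delete D by (auto simp: represents_subfunctions_def)
  have "represents (succ0 D v) v"
    using represents_delete[OF v(1,3)] v(4) delete by simp
  \<comment> \<open>Arcs go strictly downwards, so the redirection does not target the removed
    node.\<close>
  moreover have "succ0 D v \<noteq> Inner v"
    using v(3) by (auto simp: represents_def)
  ultimately show ?thesis
    using represents_subfunctions_remove[OF D] delete v by simp
qed

lemma represents_subfunctions_steps:
  assumes "(reduction_step z)\<^sup>*\<^sup>* D D'" "represents_subfunctions D"
  shows "represents_subfunctions D'"
  using assms by (induction rule: rtranclp_induct) (auto intro: represents_subfunctions_step)

text \<open>Canonicity, by induction from the bottom level upwards: two different representatives of
  one subfunction would leave a merge or a deletion possible.\<close>

lemma representative_unique:
  assumes D: "represents_subfunctions D" and red: "\<nexists>D'. reduction_step z D D'"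
    and "represents x q" "represents y q" "valid D x" "valid D y" "length q \<le> length es"
  shows "x = y"
  using assms(3-)
proof (induction "length es - length q" arbitrary: q x y rule: less_induct)
  case less
  have IH: "x' = y'" if "length q < length q'" "represents x' q'" "represents y' q'"
    "valid D x'" "valid D y'" "length q' \<le> length es" for q' x' y'
    using less.hyps[of q'] that by simp
  \<comment> \<open>Here \<open>w\<close> is the shallower vertex. If \<open>y\<close> has the same
    depth, the successors agree by induction and a merge applies; if \<open>y\<close> is deeper or
    terminal, \<open>represents_skip\<close> and induction show that \<open>w\<close> could be
    deleted.\<close>
  have main: "Inner w = y" if w: "represents (Inner w) q" "valid D (Inner w)"
    and y: "represents y q" "valid D y" and lw: "\<And>w'. y = Inner w' \<Longrightarrow> length w \<le> length w'"
    for w y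
  proof (rule ccontr)
    assume ne: "Inner w \<noteq> y"
    have wD: "w \<in> inner D" using w(2) by (simp add: valid_def)
    have len: "length q \<le> length w" "length w < length es"
      using represents_Inner_lengths[OF w(1)] by auto
    have yw: "represents y w" by (rule represents_descend[OF w(1) y(1) lw])
    have succs: "valid D (succ0 D w)" "valid D (succ1 D w)"
      "represents (succ0 D w) (w @ [False])" "represents (succ1 D w) (w @ [True])"
      using D wD by (auto simp: represents_subfunctions_def)
    show False
    proof (cases "\<exists>w'. y = Inner w' \<and> length w' = length w")
      case True
      then obtain w' where w': "y = Inner w'" "length w' = length w" by blast
      have w'D: "w' \<in> inner D" using y(2) w' by (simp add: valid_def)
      have acc: "accepts (w @ s) = accepts (w' @ s)" if "length w + length s = length es" for s
        using yw w' that by (simp add: represents_def)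
      have succs': "valid D (succ0 D w')" "valid D (succ1 D w')"
        "represents (succ0 D w') (w' @ [False])" "represents (succ1 D w') (w' @ [True])"
        using D w'D by (auto simp: represents_subfunctions_def)
      have "represents (succ0 D w') (w @ [False])" "represents (succ1 D w') (w @ [True])"
        by (rule represents_cong[OF succs'(3)] represents_cong[OF succs'(4)]; use w' acc in simp)+
      then have "succ0 D w = succ0 D w'" "succ1 D w = succ1 D w'"
        using IH[OF _ succs(3)] IH[OF _ succs(4)] succs(1,2) succs'(1,2) len by simp_all
      moreover have "lab D w = lab D w'"
        using D wD w'D w'(2) by (simp add: represents_subfunctions_def)
      moreover have "w \<noteq> w'" using ne w'(1) by simp
      ultimately have "reduction_step z D (remove_node w' (Inner w) D)"
        using wD w'D by (intro reduction_step.merge) auto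
      then show False using red by blast
    next
      case False
      then have lt: "length w < length w'" if "y = Inner w'" for w'
        using lw[OF that] that by (auto simp: le_less)
      have "valid D (if z then Bot else y)" using y(2) by (simp add: valid_def)
      then have 1: "succ1 D w = (if z then Bot else y)"
        using IH[OF _ succs(4) represents_skip(1)[OF yw lt]] succs len by simp
      have "succ0 D w = y"
        using IH[OF _ succs(3) represents_skip(2)[OF yw lt]] y(2) succs len by simp
      with 1 have "succ1 D w = (if z then Bot else succ0 D w)" by simp
      then show False using reduction_step.delete[OF wD] red by blast
    qed
  qed
  \<comment> \<open>The all-zero continuation separates \<open>Top\<close> from \<open>Bot\<close>
    under both rules.\<close>
  let ?zeros = "replicate (length es - length q) False"
  have eq: "computes x (length q) ?zeros = computes y (length q) ?zeros"
    using accepts_eq_computes[OF less.prems(1)] accepts_eq_computes[OF less.prems(2)] less.prems(5)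
    by (metis le_add_diff_inverse length_replicate)
  show ?case
  proof (cases "\<exists>w. x = Inner w \<and> (\<forall>w'. y = Inner w' \<longrightarrow> length w \<le> length w')")
    case True
    then show ?thesis using main less.prems by blast
  next
    case x: False
    show ?thesis
    proof (cases y)
      case (Inner w')
      then have "length w' \<le> length w" if "x = Inner w" for w
        using x that by auto
      then have "Inner w' = x" using Inner less.prems by (intro main) auto
      with Inner show ?thesis by simp
    next
      case Bot
      then have "\<not> computes x (length q) ?zeros"
        using eq by simp
      with Bot x show ?thesis by (cases x) auto
    next
      case Top
      then have "computes x (length q) ?zeros"
        using eq by simp
      with Top x show ?thesis by (cases x) auto
    qed
  qed
qed

lemma represents_subfunctions_tree:
  assumes "es = increasing_list R E"
  shows "represents_subfunctions (decision_tree E R \<S>)"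
  unfolding represents_subfunctions_def decision_tree_def assms[symmetric] Let_def
  by (auto simp: valid_def Suc_le_eq intro!: represents_tree_vertex)
    (auto simp: tree_vertex_def split: if_splits)

text \<open>Uniqueness of representatives, applied to a node against \<open>Bot\<close> and against
  another node of the same depth.\<close>

lemma reduced_nodes:
  assumes D: "represents_subfunctions D" and red: "\<nexists>D'. reduction_step z D D'"
    and v: "v \<in> inner D"
  shows reduced_node_satisfiable: "\<exists>s. length v + length s = length es \<and> accepts (v @ s)"
    and reduced_node_unique: "\<lbrakk>u \<in> inner D; length u = length v;
      \<And>s. length u + length s = length es \<Longrightarrow> accepts (u @ s) = accepts (v @ s)\<rbrakk> \<Longrightarrow> u = v"
proof -
  have len: "length p < length es" if "p \<in> inner D" for p
    using D that by (simp add: represents_subfunctions_def)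
  have self: "represents (Inner p) p" "valid D (Inner p)" if "p \<in> inner D" for p
    using represents_self[OF len[OF that]] that by (auto simp: valid_def)
  show "\<exists>s. length v + length s = length es \<and> accepts (v @ s)"
  proof (rule ccontr)
    assume "\<not> ?thesis"
    then have "represents Bot v" by (auto simp: represents_def)
    then have "Inner v = Bot"
      using representative_unique[OF D red self(1)[OF v], of Bot] self[OF v] len[OF v]
      by (simp add: valid_def)
    then show False by simp
  qed
  assume u: "u \<in> inner D" "length u = length v"
    "\<And>s. length u + length s = length es \<Longrightarrow> accepts (u @ s) = accepts (v @ s)"
  have "represents (Inner v) u" by (rule represents_cong[OF self(1)[OF v] u(2,3)])
  then have "Inner u = Inner v"
    using representative_unique[OF D red self(1)[OF u(1)]] self u(1) v len[OF u(1)] by simp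
  then show "u = v" by simp
qed

end

section \<open>Width and pathwidth\<close>

context shifted_matroid
begin

lemma level_width_le_pathwidth:
  assumes lin: "linear_order_on E R" and es: "es = increasing_list R E"
    and S: "\<S> = \<I> \<or> \<S> = bases \<I>"
    and steps: "(reduction_step z)\<^sup>*\<^sup>* (decision_tree E R \<S>) D" and red: "\<nexists>D'. reduction_step z D D'"
    and i: "i < card E"
  shows "level_width E R D i \<le> pathwidth E \<I> + 1"
proof -
  interpret d: decision_family es \<S> z by unfold_locales (rule distinct_es)
  have D: "d.represents_subfunctions D"
    using d.represents_subfunctions_steps[OF steps d.represents_subfunctions_tree[OF es]] .
  let ?N = "{v \<in> inner D. lab D v = es ! i}"
  \<comment> \<open>\<open>X v\<close> collects the elements taken on the path to \<open>v\<close>,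
    and \<open>Y s\<close> those taken on the continuation \<open>s\<close>, whose bit
    \<open>l\<close> belongs to index \<open>i + l\<close>.\<close>
  define X where "X v = {es ! l | l. l < i \<and> v ! l}" for v :: "bool list"
  define Y where "Y s = {es ! (i + l) | l. l < length s \<and> s ! l}" for s :: "bool list"
  have len: "length v = i" if "v \<in> ?N" for v
  proof -
    have "es ! length v = es ! i" "length v < length es"
      using that D by (auto simp: d.represents_subfunctions_def)
    then show ?thesis using i length_es distinct_es by (simp add: nth_eq_iff_index_eq)
  qed
  have pre_i: "pre i = (!) es ` {0..<i}"
    using i length_es nth_image[of i es] by (simp add: pre_def)
  have X_pre: "X v \<subseteq> pre i" for v
    by (auto simp: X_def pre_i)
  have Y_suf: "Y s \<subseteq> E - pre i" if "i + length s = length es" for s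
  proof
    fix y assume "y \<in> Y s"
    then obtain l where l: "y = es ! (i + l)" "l < length s" by (auto simp: Y_def)
    have "es ! (i + l) \<noteq> es ! m" if "m < i" for m
      using that l(2) \<open>i + length s = length es\<close> distinct_es by (simp add: nth_eq_iff_index_eq)
    then have "y \<notin> pre i" unfolding l(1) pre_i by fastforce
    moreover have "y \<in> E" using l that set_es by auto
    ultimately show "y \<in> E - pre i" by simp
  qed
  have acc: "d.accepts (v @ s) \<longleftrightarrow> X v \<union> Y s \<in> \<S>"
    if v: "length v = i" and s: "i + length s = length es" for v s
  proof -
    have "{es ! m | m. m < length es \<and> (v @ s) ! m} = X v \<union> Y s"
    proof (intro set_eqI iffI)
      fix y assume "y \<in> {es ! m | m. m < length es \<and> (v @ s) ! m}"
      then obtain m where m: "y = es ! m" "m < length es" "(v @ s) ! m" by auto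
      show "y \<in> X v \<union> Y s"
      proof (cases "m < i")
        case True
        then show ?thesis using m v by (auto simp: X_def nth_append)
      next
        case False
        then have "m = i + (m - i)" "m - i < length s" "s ! (m - i)"
          using m v s by (auto simp: nth_append)
        then show ?thesis using m(1) by (auto simp: Y_def)
      qed
    next
      fix y assume "y \<in> X v \<union> Y s"
      then show "y \<in> {es ! m | m. m < length es \<and> (v @ s) ! m}"
      proof
        assume "y \<in> X v"
        then obtain l where "y = es ! l" "l < i" "v ! l" by (auto simp: X_def)
        then show ?thesis using v s by (auto simp: nth_append intro!: exI[of _ l])
      next
        assume "y \<in> Y s"
        then obtain l where "y = es ! (i + l)" "l < length s" "s ! l" by (auto simp: Y_def)
        then show ?thesis using v s by (auto simp: nth_append intro!: exI[of _ "i + l"])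
      qed
    qed
    then show ?thesis by (simp add: d.accepts_def)
  qed
  \<comment> \<open>Nodes with equal residuals accept the same continuations, hence coincide in a
    reduced diagram.\<close>
  have "inj_on (\<lambda>v. residual \<S> i (X v)) ?N"
  proof (rule inj_onI)
    fix u v assume uv: "u \<in> ?N" "v \<in> ?N" "residual \<S> i (X u) = residual \<S> i (X v)"
    have "d.accepts (u @ s) = d.accepts (v @ s)" if "length u + length s = length es" for s
    proof -
      have s: "i + length s = length es" using that len[OF uv(1)] by simp
      have "Y s \<in> residual \<S> i (X u) \<longleftrightarrow> Y s \<in> residual \<S> i (X v)" using uv(3) by simp
      then show ?thesis
        using acc[OF len[OF uv(1)] s] acc[OF len[OF uv(2)] s] Y_suf[OF s]
        by (simp add: residual_def)
    qed
    then show "u = v"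
      using d.reduced_node_unique[OF D red, of v u] uv len by simp
  qed
  \<comment> \<open>A reduced node accepts some continuation, which excludes the empty
    residual.\<close>
  moreover have "(\<lambda>v. residual \<S> i (X v)) ` ?N \<subseteq> residual \<S> i ` Pow (pre i) - {{}}"
  proof
    fix K assume "K \<in> (\<lambda>v. residual \<S> i (X v)) ` ?N"
    then obtain v where v: "v \<in> ?N" "K = residual \<S> i (X v)" by blast
    obtain s where s: "length v + length s = length es" "d.accepts (v @ s)"
      using d.reduced_node_satisfiable[OF D red, of v] v(1) by blast
    then have "i + length s = length es" using len[OF v(1)] by simp
    then have "Y s \<in> K"
      using acc[OF len[OF v(1)]] s(2) Y_suf v(2) by (simp add: residual_def)
    then show "K \<in> residual \<S> i ` Pow (pre i) - {{}}"
      using v(2) X_pre by blast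
  qed
  ultimately have "card ?N \<le> card (residual \<S> i ` Pow (pre i) - {{}})"
    by (rule card_inj_on_le) simp
  also have "\<dots> \<le> connectivity E \<I> (pre i) + 1" by (rule card_residuals_le[OF S])
  also have "\<dots> \<le> pathwidth E \<I> + 1" using connectivity_pre_le_pathwidth[OF lin] by simp
  finally show ?thesis unfolding level_width_def es .
qed

lemma diagram_width_le_pathwidth:
  assumes "linear_order_on E R" "es = increasing_list R E" "\<S> = \<I> \<or> \<S> = bases \<I>"
    "(reduction_step z)\<^sup>*\<^sup>* (decision_tree E R \<S>) D" "\<nexists>D'. reduction_step z D D'"
  shows "diagram_width E R D \<le> pathwidth E \<I> + 1"
  unfolding diagram_width_def using level_width_le_pathwidth[OF assms] by (subst Max_le_iff) auto

end

theorem theorem4p14: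
  fixes E :: "'a set" and \<I> :: "'a set set" and R :: "'a rel"
  assumes "nested_matroid E \<I>"
    and "left_justified_order E \<I> R"
  shows "(\<forall>D. is_BDD E R \<I> D \<longrightarrow> diagram_width E R D \<le> pathwidth E \<I> + 1) \<and>
         (\<forall>D. is_BDD E R (bases \<I>) D \<longrightarrow> diagram_width E R D \<le> pathwidth E \<I> + 1) \<and>
         (\<forall>D. is_ZDD E R \<I> D \<longrightarrow> diagram_width E R D \<le> pathwidth E \<I> + 1) \<and>
         (\<forall>D. is_ZDD E R (bases \<I>) D \<longrightarrow> diagram_width E R D \<le> pathwidth E \<I> + 1)"
proof -
  have "matroid E \<I>" using assms(1) by (simp add: nested_matroid_def)
  then interpret shifted_matroid E \<I> "increasing_list R E"
    using assms(2) by (rule shifted_if_left_justified)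
  have "linear_order_on E R" using assms(2) by (simp add: left_justified_order_def)
  note width = diagram_width_le_pathwidth[OF this refl]
  show ?thesis
    unfolding is_BDD_def is_ZDD_def bdd_step_eq zdd_step_eq using width by blast
qed

end
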